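(* Let $a>0$, $\lambda>0$ and $c\in\mathbb{R}\setminus[-1,+\infty)$. Let $\{x_{n,r}\}_{r=1}^n$, $\{\eta_{n,r}^\lambda\}_{r=1}^n$ and $\{y_{n,r}\}_{r=1}^n$ be the zeros of the Charlier polynomial $C_n^{(a)}$, of $Q_n^\lambda$, and of the limit polynomial $G_n^{(a)}$, respectively, all arranged in increasing order. Then the inequalities $$y_{n,1}<\eta_{n,1}^{\lambda}<x_{n,1}<y_{n,2}<\eta_{n,2}^{\lambda}<x_{n,2}<\cdots<y_{n,n}<\eta_{n,n}^{\lambda}<x_{n,n}$$ hold for every $n\in\mathbb{N}$. Moreover, each $\eta_{n,k}^{\lambda}$ is a decreasing function of $\lambda$ and, for each $k=1,\ldots,n$, $$\lim_{\lambda\to\infty}\eta_{n,k}^{\lambda}=y_{n,k}\qquad\text{and}\qquad \lim_{\lambda\to\infty}\lambda\,[\eta_{n,k}^{\lambda}-y_{n,k}]=\frac{-C_{n}^{(a)}(y_{n,k})}{[G_{n}^{(a)}]'(y_{n,k})}.$$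
   Context: Let $a>0$ and let $\psi^{(a)}$ be the Poisson distribution, the discrete measure with mass $e^{-a}a^{x}/x!$ at $x=0,1,2,\ldots$. $\Delta f(x)=f(x+1)-f(x)$. $\{C_n^{(a)}\}_{n\ge0}$ are the monic Charlier polynomials, orthogonal with respect to $\langle p,q\rangle=\int_0^\infty pq\,d\psi^{(a)}$; $C_{-1}^{(a)}=0$, $C_0^{(a)}=1$, $C_{n+1}^{(a)}(x)=(x-n-a)C_n^{(a)}(x)-na\,C_{n-1}^{(a)}(x)$, $\|C_n^{(a)}\|^2=n!a^n$. $\{Q_n^\lambda\}_{n\ge0}$ is the sequence of monic polynomials ($\deg Q_n^\lambda=n$) orthogonal with respect to $\langle p,q\rangle_\lambda=\int_0^\infty pq\,d\psi^{(a)}+\lambda\,\Delta p(c)\,\Delta q(c)$. $$K_{n}^{(0,1)}(x,c)=\sum_{k=0}^{n}\frac{C_k^{(a)}(x)\,\Delta C_k^{(a)}(c)}{\|C_k^{(a)}\|^2},\qquad K_{n}^{(1,1)}(c,c)=\sum_{k=0}^{n}\frac{[\Delta C_k^{(a)}(c)]^2}{\|C_k^{(a)}\|^2}.$$ The limit polynomials are $$G_{n}^{(a)}(x)=\lim_{\lambda\to\infty}Q_n^\lambda(x)=C_{n}^{(a)}(x)-\frac{\Delta C_{n}^{(a)}(c)}{K_{n-1}^{(1,1)}(c,c)}K_{n-1}^{(0,1)}(x,c).$$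
   Formalization: Strict interlacing and strict decrease in λ are claimed for n≥2 only, since for n=1 all three zeros equal a (weak decrease and limits kept); the last limit is corrected to −C_n(y)/(K·G_n'(y)) with K=K_{n-1}^{(1,1)}(c,c), as the printed formula lacks the factor 1/K. *)

theory Defs
  imports "HOL-Probability.Probability" "HOL-Computational_Algebra.Computational_Algebra"
begin

definition fwd_diff :: "(real \<Rightarrow> real) \<Rightarrow> real \<Rightarrow> real" where
  "fwd_diff f x = f (x + 1) - f x"

definition charlier_ip :: "real \<Rightarrow> real poly \<Rightarrow> real poly \<Rightarrow> real" where
  "charlier_ip a p q =
     measure_pmf.expectation (poisson_pmf a) (\<lambda>x. poly p (real x) * poly q (real x))"

fun charlier :: "real \<Rightarrow> nat \<Rightarrow> real poly" where
  "charlier a 0 = 1"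
| "charlier a (Suc 0) = [:- a, 1:]"
| "charlier a (Suc (Suc n)) =
     [:- real (Suc n) - a, 1:] * charlier a (Suc n) - smult (real (Suc n) * a) (charlier a n)"

definition sobolev_ip :: "real \<Rightarrow> real \<Rightarrow> real \<Rightarrow> real poly \<Rightarrow> real poly \<Rightarrow> real" where
  "sobolev_ip a c t p q =
     charlier_ip a p q + t * fwd_diff (poly p) c * fwd_diff (poly q) c"

definition monic_orthogonal ::
  "(real poly \<Rightarrow> real poly \<Rightarrow> real) \<Rightarrow> (nat \<Rightarrow> real poly) \<Rightarrow> bool" where
  "monic_orthogonal ip P \<longleftrightarrow>
     (\<forall>n. degree (P n) = n \<and> lead_coeff (P n) = 1) \<and>
     (\<forall>m n. m \<noteq> n \<longrightarrow> ip (P m) (P n) = 0)"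

(* For a > 0 and t > 0 the form sobolev_ip a c t is positive definite, so there is exactly one
   such sequence. *)
definition sobolev_charlier :: "real \<Rightarrow> real \<Rightarrow> real \<Rightarrow> nat \<Rightarrow> real poly" where
  "sobolev_charlier a c t = (THE Q. monic_orthogonal (sobolev_ip a c t) Q)"

definition kernel01 :: "real \<Rightarrow> real \<Rightarrow> nat \<Rightarrow> real poly" where
  "kernel01 a c n =
     (\<Sum>k\<le>n. smult (fwd_diff (poly (charlier a k)) c / charlier_ip a (charlier a k) (charlier a k))
                 (charlier a k))"

definition kernel11 :: "real \<Rightarrow> real \<Rightarrow> nat \<Rightarrow> real" where
  "kernel11 a c n =
     (\<Sum>k\<le>n. (fwd_diff (poly (charlier a k)) c)\<^sup>2 / charlier_ip a (charlier a k) (charlier a k))"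

(* Used for n \<ge> 1. For n = 1 both kernels vanish (the difference of a constant is 0) and, since
   x / 0 = 0, the value is charlier a 1. This is also the limit of sobolev_charlier a c t 1 as
   t tends to infinity, because that polynomial is charlier a 1 for every t. *)
definition limit_charlier :: "real \<Rightarrow> real \<Rightarrow> nat \<Rightarrow> real poly" where
  "limit_charlier a c n =
     charlier a n -
     smult (fwd_diff (poly (charlier a n)) c / kernel11 a c (n - 1)) (kernel01 a c (n - 1))"

(* Real zeros with multiplicity. If their number equals the degree, they are all the zeros. *)
definition zeros :: "real poly \<Rightarrow> real list" where
  "zeros p = sorted_list_of_multiset (proots p)"

(* Zeros are numbered from 1. *)
definition nth_zero :: "real poly \<Rightarrow> nat \<Rightarrow> real" where
  "nth_zero p k = zeros p ! (k - 1)"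

end

theory Submission
  imports Defs
begin

text \<open>
  Write \<open>K = kernel11 a c (n - 1)\<close>. Expanding in Charlier polynomials gives
  \<open>(1 + \<lambda> K) Q\<^sub>n = C\<^sub>n + \<lambda> K G\<^sub>n\<close>, so the
  problem reduces to a pencil spanned by \<open>C\<^sub>n\<close> and \<open>G\<^sub>n\<close>. At a zero \<open>x\<^sub>k\<close> of
  \<open>C\<^sub>n\<close> the Christoffel-Darboux formula turns \<open>G\<^sub>n(x\<^sub>k)\<close> into a product of
  \<open>C\<^sub>n\<^sub>-\<^sub>1(x\<^sub>k)\<close> with the forward differences at \<open>c\<close> of \<open>C\<^sub>n\<close> and of
  \<open>C\<^sub>n(y) / (y - x\<^sub>k)\<close>. Both \<open>c\<close> and \<open>c + 1\<close> lie to the left of all zeros, so these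
  differences have a fixed sign and \<open>G\<^sub>n\<close> alternates in sign along the zeros of \<open>C\<^sub>n\<close>.
  Each member of the pencil then changes sign between \<open>y\<^sub>k\<close> and \<open>x\<^sub>k\<close>.
  Comparing signs at \<open>\<eta>\<^sub>k(\<lambda>)\<close> for two parameters gives monotonicity and the limit, and dividing
  \<open>C\<^sub>n + \<lambda> K G\<^sub>n = 0\<close> by \<open>G\<^sub>n(\<eta>) / (\<eta> - y\<^sub>k)\<close> gives the rate of convergence.
\<close>

subsection \<open>Real polynomials with simple real zeros\<close>

lemma opposite_signs:
  fixes x y :: real
  assumes "0 < (-1) ^ Suc m * x" "0 < (-1) ^ m * y"
  shows "x * y < 0"
  using assms by (cases "even m") (auto simp: mult_pos_neg mult_neg_pos)

text \<open>The intermediate value theorem puts a zero strictly inside each of \<open>n\<close>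
  disjoint intervals. The degree leaves no room for further zeros or multiplicities, so the sorted
  list runs through the intervals in order.\<close>

lemma bracketed_zeros:
  fixes p :: "real poly"
  assumes deg: "degree p = n" and "p \<noteq> 0"
    and lt: "\<And>k. k < n \<Longrightarrow> u k < v k"
    and sign: "\<And>k. k < n \<Longrightarrow> poly p (u k) * poly p (v k) < 0"
    and le: "\<And>k. Suc k < n \<Longrightarrow> v k \<le> u (Suc k)"
  shows "length (zeros p) = n"
    and "sorted_wrt (<) (zeros p)"
    and "\<And>k. k < n \<Longrightarrow> u k < zeros p ! k \<and> zeros p ! k < v k"
proof -
  have "\<exists>z. u k < z \<and> z < v k \<and> poly p z = 0" if "k < n" for k
    using poly_IVT[OF lt[OF that] sign[OF that]] by blast
  then obtain z where z: "\<And>k. k < n \<Longrightarrow> u k < z k \<and> z k < v k \<and> poly p (z k) = 0"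
    by metis
  define xs where "xs = map z [0..<n]"
  have "z i < z (Suc i)" if "Suc i < n" for i
    using z[of i] z[of "Suc i"] le[of i] that by force
  then have sorted: "sorted_wrt (<) xs"
    unfolding xs_def by (subst sorted_wrt_iff_nth_Suc_transp) auto
  then have distinct: "distinct xs"
    by (simp add: strict_sorted_iff)
  \<comment> \<open>The chosen zeros form a submultiset of \<open>proots p\<close> whose size
    already reaches the degree bound, which forces equality.\<close>
  have "mset_set (set xs) \<subseteq># mset_set (set_mset (proots p))"
    using z \<open>p \<noteq> 0\<close> by (intro subset_imp_msubset_mset_set) (auto simp: xs_def poly_roots_finite)
  then have "mset xs \<subseteq># proots p"
    using distinct mset_set_set_mset_msubset by (metis mset_set_set subset_mset.order_trans)
  moreover have "size (proots p) \<le> size (mset xs)"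
    using size_proots_le[of p] deg by (simp add: xs_def)
  ultimately have "proots p = mset xs"
    by (metis leD mset_subset_size subset_mset.le_imp_less_or_eq)
  then have "zeros p = xs"
    using sorted by (simp add: zeros_def strict_sorted_iff sorted_sort_id)
  with sorted z show "length (zeros p) = n" "sorted_wrt (<) (zeros p)"
    "\<And>k. k < n \<Longrightarrow> u k < zeros p ! k \<and> zeros p ! k < v k"
    by (auto simp: xs_def)
qed

lemma poly_zeros_nth:
  assumes "k < length (zeros p)"
  shows "poly p (zeros p ! k) = 0"
proof -
  have "zeros p ! k \<in> set (zeros p)" using assms by simp
  then have "zeros p ! k \<in># proots p" by (simp add: zeros_def)
  then show ?thesis by (cases "p = 0") auto
qed

text \<open>Both sides are monic of degree \<open>n\<close>, so their difference has degree below
  \<open>n\<close>, yet it vanishes at \<open>n\<close> distinct points.\<close>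

lemma poly_eq_prod_zeros:
  fixes p :: "real poly"
  assumes deg: "degree p = n" and monic: "lead_coeff p = 1"
    and len: "length (zeros p) = n" and sorted: "sorted_wrt (<) (zeros p)"
  shows "poly p x = (\<Prod>j<n. x - zeros p ! j)"
proof -
  let ?q = "\<Prod>j<n. [:- (zeros p ! j), 1:]"
  have "degree ?q = n"
    by (simp add: degree_prod_sum_eq)
  moreover have "lead_coeff ?q = 1"
    by (subst lead_coeff_prod) simp
  ultimately have q: "degree ?q = n" "lead_coeff ?q = 1" .
  have card: "card (set (zeros p)) = n"
    using len sorted by (simp add: distinct_card strict_sorted_iff)
  have "p - ?q = 0"
  proof (rule ccontr)
    assume nz: "p - ?q \<noteq> 0"
    have "degree (p - ?q) \<le> n"
      using deg q by (intro degree_diff_le) auto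
    moreover have "coeff (p - ?q) n = 0"
      using deg monic q by simp
    ultimately have "degree (p - ?q) < n"
      using nz by (metis leading_coeff_0_iff le_neq_implies_less)
    moreover have "set (zeros p) \<subseteq> {x. poly (p - ?q) x = 0}"
    proof
      fix x assume "x \<in> set (zeros p)"
      then obtain j where "j < n" "x = zeros p ! j"
        using len by (auto simp: in_set_conv_nth)
      then show "x \<in> {x. poly (p - ?q) x = 0}"
        using poly_zeros_nth[of j p] len by (auto simp: poly_prod)
    qed
    then have "n \<le> card {x. poly (p - ?q) x = 0}"
      using card nz by (metis card_mono poly_roots_finite)
    ultimately show False
      using card_poly_roots_bound[OF nz] by linarith
  qed
  then have "poly p x = poly ?q x" by simp
  then show ?thesis by (simp add: poly_prod)
qed

lemma sign_prod_diff:
  fixes z :: "nat \<Rightarrow> real"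
  assumes "k \<le> n" "\<And>j. j < k \<Longrightarrow> z j < x" "\<And>j. k \<le> j \<Longrightarrow> j < n \<Longrightarrow> x < z j"
  shows "0 < (-1) ^ (n - k) * (\<Prod>j<n. x - z j)"
  using assms
proof (induction "n - k" arbitrary: n)
  case 0
  then have "n = k" by simp
  with 0 show ?case by (auto intro!: prod_pos)
next
  case (Suc d)
  then obtain m where m: "n = Suc m" "k \<le> m" "d = m - k"
    by (cases n) auto
  have "0 < (-1) ^ (m - k) * (\<Prod>j<m. x - z j)"
    using Suc m by auto
  moreover have "x - z m < 0"
    using Suc.prems(3)[of m] m by auto
  ultimately have "((-1) ^ (m - k) * (\<Prod>j<m. x - z j)) * (x - z m) < 0"
    by (rule mult_pos_neg)
  then show ?case
    using m by (simp add: Suc_diff_le algebra_simps)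
qed

text \<open>Exactly \<open>n - k\<close> zeros lie to the right of \<open>x\<close>, and each
  contributes a minus sign. The guards on \<open>k\<close> let \<open>k = 0\<close> and
  \<open>k = n\<close> stand for the two outer half-lines.\<close>

lemma sign_between_zeros:
  fixes p :: "real poly"
  assumes p: "degree p = n" "lead_coeff p = 1" "length (zeros p) = n" "sorted_wrt (<) (zeros p)"
    and k: "k \<le> n" "0 < k \<Longrightarrow> zeros p ! (k - 1) < x" "k < n \<Longrightarrow> x < zeros p ! k"
  shows "0 < (-1) ^ (n - k) * poly p x"
  unfolding poly_eq_prod_zeros[OF p]
proof (rule sign_prod_diff[OF k(1)])
  have mono: "zeros p ! i \<le> zeros p ! j" if "i \<le> j" "j < n" for i j
    using that p by (cases "i = j") (auto simp: sorted_wrt_iff_nth_less less_imp_le)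
  show "zeros p ! j < x" if "j < k" for j
    using that k mono[of j "k - 1"] by force
  show "x < zeros p ! j" if "k \<le> j" "j < n" for j
    using that k mono[of k j] by force
qed

lemma monic_positive_above:
  fixes p :: "real poly"
  assumes "lead_coeff p = 1"
  obtains M where "M > b" "poly p M > 0"
proof -
  obtain N where "\<And>x. x \<ge> N \<Longrightarrow> poly p x \<ge> 1"
    using poly_pinfty_gt_lc[of p] assms by auto
  then show thesis
    using that[of "max N (b + 1)"] by (smt (verit) max.cobounded1 max.cobounded2)
qed

lemma monic_sign_below:
  fixes p :: "real poly"
  assumes "lead_coeff p = 1" "degree p = n"
  obtains M where "M < b" "0 < (-1) ^ n * poly p M"
proof -
  \<comment> \<open>Reflection exchanges the two ends of the line, and the factor
    \<open>(-1) ^ n\<close> makes the reflected polynomial monic again.\<close>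
  let ?q = "smult ((-1) ^ n) (pcompose p [:0, -1:])"
  have "lead_coeff ?q = (-1) ^ n * (-1) ^ n"
    using assms by (simp add: lead_coeff_comp)
  also have "\<dots> = 1"
    by (metis minus_one_mult_self)
  finally obtain M where "M > - b" "poly ?q M > 0"
    using monic_positive_above by metis
  then show thesis
    using that[of "- M"] by (simp add: poly_pcompose)
qed

lemma alternating_zeros:
  fixes p :: "real poly"
  assumes p: "degree p = n" "p \<noteq> 0"
    and w: "\<And>k. k < n \<Longrightarrow> w k < w (Suc k)" "\<And>k. k \<le> n \<Longrightarrow> 0 < (-1) ^ (n - k) * poly p (w k)"
  shows "length (zeros p) = n"
    and "sorted_wrt (<) (zeros p)"
    and "\<And>k. k < n \<Longrightarrow> w k < zeros p ! k \<and> zeros p ! k < w (Suc k)"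
proof -
  have "poly p (w k) * poly p (w (Suc k)) < 0" if "k < n" for k
    using opposite_signs[of "n - Suc k" "poly p (w k)"] w(2)[of k] w(2)[of "Suc k"] that
    by (simp add: Suc_diff_Suc del: power_Suc)
  then show "length (zeros p) = n" "sorted_wrt (<) (zeros p)"
    "\<And>k. k < n \<Longrightarrow> w k < zeros p ! k \<and> zeros p ! k < w (Suc k)"
    using bracketed_zeros[OF p, of w "\<lambda>k. w (Suc k)"] w(1) by blast+
qed

subsection \<open>Pencils of interlacing polynomials\<close>

text \<open>Later \<open>p\<close>, \<open>q\<close> and \<open>r t\<close> are the Charlier, the
  limit and the Sobolev polynomial. The pencil equation makes \<open>r t\<close> a convex
  combination of \<open>p\<close> and \<open>q\<close> whose weight moves to \<open>q\<close> as
  \<open>t\<close> grows.\<close>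

locale interlacing_pencil =
  fixes p q :: "real poly" and r :: "real \<Rightarrow> real poly" and K :: real and n :: nat
  assumes p: "degree p = n" "lead_coeff p = 1" "length (zeros p) = n" "sorted_wrt (<) (zeros p)"
    and q: "degree q = n" "lead_coeff q = 1" "length (zeros q) = n" "sorted_wrt (<) (zeros q)"
    and r: "\<And>t. t > 0 \<Longrightarrow> degree (r t) = n" "\<And>t. t > 0 \<Longrightarrow> lead_coeff (r t) = 1"
    and K: "K > 0"
    and pencil: "\<And>t x. t > 0 \<Longrightarrow> (1 + t * K) * poly (r t) x = poly p x + t * K * poly q x"
    and zeros_less: "\<And>k. k < n \<Longrightarrow> zeros q ! k < zeros p ! k"
    and less_zeros: "\<And>k. Suc k < n \<Longrightarrow> zeros p ! k < zeros q ! Suc k"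
begin

lemma sign_left:
  assumes "k < n"
  shows "0 < (-1) ^ (n - k) * poly p (zeros q ! k)"
  using assms zeros_less[of k] less_zeros[of "k - 1"] by (intro sign_between_zeros p) auto

lemma sign_right:
  assumes "k < n" "zeros q ! k < x" "x \<le> zeros p ! k"
  shows "0 < (-1) ^ (n - Suc k) * poly q x"
  using assms less_zeros[of k] by (intro sign_between_zeros q) auto

text \<open>At a zero of \<open>q\<close> only the \<open>p\<close> term of the pencil survives, at
  a zero of \<open>p\<close> only the \<open>q\<close> term. Interlacing gives these two terms
  opposite signs at zeros of equal index.\<close>

lemma zeros_pencil:
  assumes t: "t > 0"
  shows "length (zeros (r t)) = n" and "sorted_wrt (<) (zeros (r t))"
    and "\<And>k. k < n \<Longrightarrow> zeros q ! k < zeros (r t) ! k \<and> zeros (r t) ! k < zeros p ! k"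
proof -
  have pos: "1 + t * K > 0" "t * K > 0" using t K by (auto intro: add_pos_pos)
  have "poly (r t) (zeros q ! k) * poly (r t) (zeros p ! k) < 0" if "k < n" for k
  proof (rule opposite_signs[of "n - Suc k"])
    have eq: "(1 + t * K) * poly (r t) (zeros q ! k) = poly p (zeros q ! k)"
      "(1 + t * K) * poly (r t) (zeros p ! k) = t * K * poly q (zeros p ! k)"
      using that pencil[OF t] poly_zeros_nth p(3) q(3) by simp_all
    have "0 < (-1) ^ (n - k) * ((1 + t * K) * poly (r t) (zeros q ! k))"
      unfolding eq using sign_left[OF that] .
    then show "0 < (-1) ^ Suc (n - Suc k) * poly (r t) (zeros q ! k)"
      using pos that by (simp add: Suc_diff_Suc mult.left_commute[of "(-1) ^ _"] zero_less_mult_iff del: power_Suc)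
    have "0 < (t * K) * ((-1) ^ (n - Suc k) * poly q (zeros p ! k))"
      by (rule mult_pos_pos[OF pos(2) sign_right[OF that zeros_less[OF that] order_refl]])
    then have "0 < (-1) ^ (n - Suc k) * ((1 + t * K) * poly (r t) (zeros p ! k))"
      unfolding eq by (simp only: mult.left_commute[of "(-1) ^ _"])
    then show "0 < (-1) ^ (n - Suc k) * poly (r t) (zeros p ! k)"
      using pos by (simp add: mult.left_commute[of "(-1) ^ _"] zero_less_mult_iff)
  qed
  moreover have "r t \<noteq> 0" using r(2)[OF t] by auto
  ultimately show "length (zeros (r t)) = n" "sorted_wrt (<) (zeros (r t))"
    "\<And>k. k < n \<Longrightarrow> zeros q ! k < zeros (r t) ! k \<and> zeros (r t) ! k < zeros p ! k"
    using bracketed_zeros[OF r(1)[OF t], of "\<lambda>k. zeros q ! k" "\<lambda>k. zeros p ! k"]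
      zeros_less less_zeros by (blast intro: less_imp_le)+
qed

text \<open>A one-sided location test: if \<open>w\<close> were not to the right of zero
  \<open>k\<close> of \<open>r t\<close>, it would still be to the right of the preceding zero, so
  \<open>r t\<close> would vanish or have the opposite sign at \<open>w\<close>.\<close>

lemma zeros_pencil_less:
  assumes t: "t > 0" and k: "k < n" and w: "zeros q ! k < w"
    and sign: "0 < (-1) ^ (n - Suc k) * (poly p w + t * K * poly q w)"
  shows "zeros (r t) ! k < w"
proof (rule ccontr)
  assume not_less: "\<not> ?thesis"
  have "1 + t * K > 0" using t K by (auto intro: add_pos_pos)
  then have sign': "0 < (-1) ^ (n - Suc k) * poly (r t) w"
    using sign unfolding pencil[OF t, symmetric]
    by (simp add: mult.left_commute[of "(-1) ^ _"] zero_less_mult_iff)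
  then have "w \<noteq> zeros (r t) ! k"
    using poly_zeros_nth[of k "r t"] zeros_pencil(1)[OF t] k by auto
  \<comment> \<open>Chain:
    \<open>zeros (r t) ! (k - 1) < zeros p ! (k - 1) < zeros q ! k < w\<close>.\<close>
  moreover have "zeros (r t) ! (k - 1) < w" if "0 < k"
    using zeros_pencil(3)[OF t, of "k - 1"] less_zeros[of "k - 1"] less_imp_diff_less[OF k, of 1]
      k w that by simp
  ultimately have "0 < (-1) ^ (n - k) * poly (r t) w"
    using not_less k by (intro sign_between_zeros r[OF t] zeros_pencil[OF t]) auto
  then have "0 < (-1) ^ Suc (n - Suc k) * poly (r t) w"
    using k by (simp add: Suc_diff_Suc del: power_Suc)
  with sign' show False by simp
qed

text \<open>At the zero belonging to \<open>s\<close>, \<open>p\<close> equals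
  \<open>- s * K\<close> times \<open>q\<close>. The combination for \<open>t\<close> is then
  \<open>(t - s) * K\<close> times \<open>q\<close>, of known sign there, and the location test
  applies.\<close>

lemma zeros_pencil_decreasing:
  assumes "0 < s" "s < t" and k: "k < n"
  shows "zeros (r t) ! k < zeros (r s) ! k"
proof (rule zeros_pencil_less)
  let ?w = "zeros (r s) ! k"
  note bounds = zeros_pencil(3)[OF \<open>0 < s\<close> k]
  have "poly p ?w + s * K * poly q ?w = 0"
    using pencil[OF \<open>0 < s\<close>, of ?w] poly_zeros_nth[of k "r s"] zeros_pencil(1)[OF \<open>0 < s\<close>] k
    by simp
  then have "poly p ?w + t * K * poly q ?w = ((t - s) * K) * poly q ?w"
    by (simp add: algebra_simps)
  moreover have "0 < ((t - s) * K) * ((-1) ^ (n - Suc k) * poly q ?w)"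
    by (rule mult_pos_pos[OF mult_pos_pos sign_right[OF k]]) (use assms K bounds in auto)
  ultimately show "0 < (-1) ^ (n - Suc k) * (poly p ?w + t * K * poly q ?w)"
    by (simp only: mult.left_commute[of "(-1) ^ _"])
qed (use assms zeros_pencil(3)[OF \<open>0 < s\<close> k] in auto)

text \<open>The zeros stay to the right of the zero of \<open>q\<close>. At any fixed
  \<open>w\<close> slightly further right the \<open>q\<close> term dominates for large
  \<open>t\<close>, and the location test puts the zero to the left of \<open>w\<close>.\<close>

lemma zeros_pencil_tendsto:
  assumes k: "k < n"
  shows "((\<lambda>t. zeros (r t) ! k) \<longlongrightarrow> zeros q ! k) at_top"
proof (rule order_tendstoI)
  fix l assume "l < zeros q ! k"
  show "\<forall>\<^sub>F t in at_top. l < zeros (r t) ! k"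
    using eventually_gt_at_top[of "0::real"]
  proof eventually_elim
    case (elim t)
    then show ?case using zeros_pencil(3)[OF elim(1) k] \<open>l < zeros q ! k\<close> by linarith
  qed
next
  fix u assume "zeros q ! k < u"
  then obtain w where w: "zeros q ! k < w" "w < min u (zeros p ! k)"
    using zeros_less[OF k] dense[of "zeros q ! k" "min u (zeros p ! k)"] by auto
  \<comment> \<open>\<open>b + t * d\<close> is the signed value of the pencil at \<open>w\<close>;
    since \<open>d > 0\<close>, it is positive once \<open>t\<close> exceeds
    \<open>- b / d\<close>.\<close>
  define b where "b = (-1) ^ (n - Suc k) * poly p w"
  define d where "d = K * ((-1) ^ (n - Suc k) * poly q w)"
  have "d > 0"
    unfolding d_def using w by (intro mult_pos_pos[OF K sign_right[OF k]]) auto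
  show "\<forall>\<^sub>F t in at_top. zeros (r t) ! k < u"
    using eventually_gt_at_top[of "0::real"] eventually_gt_at_top[of "- b / d"]
  proof eventually_elim
    case (elim t)
    have "0 < b + t * d"
      using elim(2) \<open>d > 0\<close> by (simp add: field_simps)
    also have "\<dots> = (-1) ^ (n - Suc k) * (poly p w + t * K * poly q w)"
      by (simp add: b_def d_def algebra_simps)
    finally show ?case
      using zeros_pencil_less[OF elim(1) k w(1)] w(2) by simp
  qed
qed

text \<open>With q(x) = (x - y) g(x), the pencil equation at \<eta> reads p(\<eta>) + t K (\<eta> -
  y) g(\<eta>) = 0. Solving for t (\<eta> - y) and letting \<eta> tend to y gives the limit.
  \<open>K\<close> stays in the denominator because the weight of \<open>q\<close> is
  \<open>t * K\<close>.\<close>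

lemma zeros_pencil_rate:
  assumes k: "k < n"
  shows "((\<lambda>t. t * (zeros (r t) ! k - zeros q ! k)) \<longlongrightarrow>
    - poly p (zeros q ! k) / (K * poly (pderiv q) (zeros q ! k))) at_top"
proof -
  define y where "y = zeros q ! k"
  define \<eta> where "\<eta> t = zeros (r t) ! k" for t
  define g where "g x = (\<Prod>j\<in>{..<n} - {k}. x - zeros q ! j)" for x
  have q_eq: "poly q x = (x - y) * g x" for x
    unfolding poly_eq_prod_zeros[OF q] g_def y_def using k by (subst prod.remove[of _ k]) auto
  have g_cont: "isCont g x" for x
    unfolding g_def by (intro continuous_intros)
  \<comment> \<open>Caratheodory's criterion: \<open>g\<close> is a continuous difference quotient
    of \<open>q\<close> at \<open>y\<close>.\<close>
  have "(poly q has_real_derivative g y) (at y)"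
    unfolding CARAT_DERIV using g_cont by (intro exI[of _ g]) (simp add: q_eq mult.commute)
  then have deriv: "poly (pderiv q) y = g y"
    using poly_DERIV DERIV_unique by blast
  have "zeros q ! j \<noteq> y" if "j < n" "j \<noteq> k" for j
    using q(3,4) k that by (auto simp: y_def nth_eq_iff_index_eq strict_sorted_iff)
  then have "g y \<noteq> 0" by (force simp: g_def)
  have \<eta>: "(\<eta> \<longlongrightarrow> y) at_top"
    unfolding \<eta>_def y_def by (rule zeros_pencil_tendsto[OF k])
  have g_lim: "((\<lambda>t. g (\<eta> t)) \<longlongrightarrow> g y) at_top"
    using isCont_tendsto_compose[OF g_cont \<eta>] .
  have "((\<lambda>t. - poly p (\<eta> t) / (K * g (\<eta> t))) \<longlongrightarrow> - poly p y / (K * g y)) at_top"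
    using K \<open>g y \<noteq> 0\<close> by (intro tendsto_intros \<eta> g_lim) auto
  moreover have "\<forall>\<^sub>F t in at_top. - poly p (\<eta> t) / (K * g (\<eta> t)) = t * (\<eta> t - y)"
    using eventually_gt_at_top[of "0::real"] tendsto_imp_eventually_ne[OF g_lim \<open>g y \<noteq> 0\<close>]
  proof eventually_elim
    case (elim t)
    have "poly (r t) (\<eta> t) = 0"
      unfolding \<eta>_def using poly_zeros_nth zeros_pencil(1)[OF elim(1)] k by simp
    then have "- poly p (\<eta> t) = t * (\<eta> t - y) * (K * g (\<eta> t))"
      using pencil[OF elim(1), of "\<eta> t"] by (simp add: q_eq algebra_simps)
    then show ?case
      using elim(2) K by simp
  qed
  ultimately have "((\<lambda>t. t * (\<eta> t - y)) \<longlongrightarrow> - poly p y / (K * g y)) at_top"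
    by (rule Lim_transform_eventually)
  then show ?thesis
    by (simp only: \<eta>_def y_def deriv[unfolded y_def])
qed

end

subsection \<open>Polynomials under the Poisson distribution\<close>

lemma integral_poisson:
  fixes f :: "nat \<Rightarrow> real"
  assumes a: "a > 0"
  shows "integrable (measure_pmf (poisson_pmf a)) f \<longleftrightarrow> summable (\<lambda>n. a ^ n / fact n * \<bar>f n\<bar>)"
    and "integrable (measure_pmf (poisson_pmf a)) f \<Longrightarrow>
      (\<lambda>n. exp (- a) * (a ^ n / fact n * f n)) sums measure_pmf.expectation (poisson_pmf a) f"
proof -
  have iff: "integrable (measure_pmf (poisson_pmf a)) f \<longleftrightarrow>
      integrable (count_space UNIV) (\<lambda>n. exp (- a) * (a ^ n / fact n * f n))"
    unfolding measure_pmf_eq_density using a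
    by (subst integrable_density) (auto simp: mult_ac)
  also have "\<dots> \<longleftrightarrow> summable (\<lambda>n. exp (- a) * (a ^ n / fact n * \<bar>f n\<bar>))"
    using a by (simp add: integrable_count_space_nat_iff abs_mult)
  also have "\<dots> \<longleftrightarrow> summable (\<lambda>n. a ^ n / fact n * \<bar>f n\<bar>)"
    by (subst summable_cmult_iff) auto
  finally show "integrable (measure_pmf (poisson_pmf a)) f \<longleftrightarrow> summable (\<lambda>n. a ^ n / fact n * \<bar>f n\<bar>)" .
  have "measure_pmf.expectation (poisson_pmf a) f =
      integral\<^sup>L (count_space UNIV) (\<lambda>n. exp (- a) * (a ^ n / fact n * f n))"
    unfolding measure_pmf_eq_density using a
    by (subst integral_density) (auto simp: mult_ac)
  then show "(\<lambda>n. exp (- a) * (a ^ n / fact n * f n)) sums measure_pmf.expectation (poisson_pmf a) f"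
    if "integrable (measure_pmf (poisson_pmf a)) f"
    using sums_integral_count_space_nat[of "\<lambda>n. exp (- a) * (a ^ n / fact n * f n)"] that iff by simp
qed

text \<open>The termwise form of the Poisson identity E[X f(X - 1)] = a E[f(X)].\<close>

lemma poisson_shift_weight:
  "a ^ Suc n / fact (Suc n) * (real (Suc n) * y) = a * (a ^ n / fact n * y)" for a y :: real
proof -
  have "(fact (Suc n) :: real) = real (Suc n) * fact n"
    by (simp only: fact_Suc of_nat_mult)
  then show ?thesis
    by (simp del: fact_Suc of_nat_Suc)
qed

lemma summable_poisson_shift:
  fixes f :: "nat \<Rightarrow> real"
  assumes "summable (\<lambda>n. a ^ n / fact n * f n)"
  shows "summable (\<lambda>n. a ^ n / fact n * (real n * f (n - 1)))"
proof -
  have "summable (\<lambda>n. a ^ Suc n / fact (Suc n) * (real (Suc n) * f (Suc n - 1)))"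
    unfolding poisson_shift_weight using summable_mult[OF assms, of a] by simp
  then show ?thesis
    by (subst (asm) summable_Suc_iff)
qed

text \<open>Induction on the degree: p(x) = b + x q(x) = b + x r(x - 1), where r(x) = q(x + 1) has
  smaller degree, and the shift lemma transfers summability from r to x r(x - 1).\<close>

lemma summable_poisson_poly:
  fixes p :: "real poly"
  assumes a: "a > 0"
  shows "summable (\<lambda>n. a ^ n / fact n * \<bar>poly p (real n)\<bar>)"
proof (induction "degree p" arbitrary: p rule: less_induct)
  case less
  have const: "summable (\<lambda>n. a ^ n / fact n * \<bar>b\<bar>)" for b :: real
    using summable_exp[of a] by (intro summable_mult2) (simp add: field_simps)
  show ?case
  proof (cases "degree p = 0")
    case True
    then show ?thesis using const by (auto elim: degree_eq_zeroE)
  next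
    case False
    obtain b q where p: "p = pCons b q" by (cases p)
    define r where "r = pcompose q [:1, 1:]"
    have "degree r < degree p"
      using False p by (auto simp: r_def degree_pcompose split: if_splits)
    from summable_poisson_shift[OF less[OF this]]
    have "summable (\<lambda>n. a ^ n / fact n * (real n * \<bar>poly r (real (n - 1))\<bar>))" .
    with const[of b] have "summable (\<lambda>n. a ^ n / fact n * \<bar>b\<bar>
        + a ^ n / fact n * (real n * \<bar>poly r (real (n - 1))\<bar>))"
      by (rule summable_add)
    then show ?thesis
    proof (rule summable_comparison_test'[where N = 0])
      fix n :: nat
      have "real n * \<bar>poly r (real (n - 1))\<bar> = \<bar>real n * poly q (real n)\<bar>"
        by (cases n) (auto simp: r_def poly_pcompose abs_mult add.commute)
      then have "\<bar>poly p (real n)\<bar> \<le> \<bar>b\<bar> + real n * \<bar>poly r (real (n - 1))\<bar>"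
        by (simp add: p)
      then have "a ^ n / fact n * \<bar>poly p (real n)\<bar> \<le>
          a ^ n / fact n * (\<bar>b\<bar> + real n * \<bar>poly r (real (n - 1))\<bar>)"
        using a by (intro mult_left_mono) auto
      then show "norm (a ^ n / fact n * \<bar>poly p (real n)\<bar>) \<le>
          a ^ n / fact n * \<bar>b\<bar> + a ^ n / fact n * (real n * \<bar>poly r (real (n - 1))\<bar>)"
        using a by (simp add: distrib_left)
    qed
  qed
qed

lemma integrable_poisson_poly [simp]:
  assumes "a > 0"
  shows "integrable (measure_pmf (poisson_pmf a)) (\<lambda>n. poly p (real n))"
  using integral_poisson(1) summable_poisson_poly assms by blast

text \<open>\<open>charlier_ip\<close> depends only on the product of its arguments, so it is
  studied through a linear functional of one polynomial.\<close>

definition poisson_mean :: "real \<Rightarrow> real poly \<Rightarrow> real" where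
  "poisson_mean a p = measure_pmf.expectation (poisson_pmf a) (\<lambda>n. poly p (real n))"

lemma charlier_ip_eq: "charlier_ip a p q = poisson_mean a (p * q)"
  by (simp add: charlier_ip_def poisson_mean_def)

lemma poisson_mean_add: "a > 0 \<Longrightarrow> poisson_mean a (p + q) = poisson_mean a p + poisson_mean a q"
  and poisson_mean_diff: "a > 0 \<Longrightarrow> poisson_mean a (p - q) = poisson_mean a p - poisson_mean a q"
  and poisson_mean_smult: "poisson_mean a (smult b p) = b * poisson_mean a p"
  and poisson_mean_1: "poisson_mean a 1 = 1"
  by (simp_all add: poisson_mean_def)

lemma poisson_mean_shift:
  assumes a: "a > 0"
  shows "poisson_mean a ([:0, 1:] * pcompose p [:-1, 1:]) = a * poisson_mean a p"
proof -
  let ?q = "[:0, 1:] * pcompose p [:-1, 1:]"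
  let ?g = "\<lambda>n. exp (- a) * (a ^ n / fact n * poly ?q (real n))"
  have "?g (Suc n) = a * (exp (- a) * (a ^ n / fact n * poly p (real n)))" for n
    using poisson_shift_weight[of a n "poly p (real n)"]
    by (simp add: poly_pcompose del: power_Suc fact_Suc)
  then have "(\<lambda>n. ?g (Suc n)) sums (a * poisson_mean a p)"
    using sums_mult[OF integral_poisson(2)[OF a integrable_poisson_poly[OF a]], of a p]
    by (simp add: poisson_mean_def del: power_Suc fact_Suc)
  \<comment> \<open>The term at index 0 vanishes because of the factor \<open>[:0, 1:]\<close>, so
    the series may start at 0 or at 1.\<close>
  then have "?g sums (a * poisson_mean a p)"
    by (subst (asm) sums_Suc_iff) simp
  moreover have "?g sums poisson_mean a ?q"
    unfolding poisson_mean_def by (intro integral_poisson(2) integrable_poisson_poly a)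
  ultimately show ?thesis by (rule sums_unique2[symmetric])
qed

text \<open>The Poisson distribution charges every natural number, so a square of mean 0 belongs to
  a polynomial with infinitely many zeros.\<close>

lemma poisson_mean_square:
  assumes a: "a > 0"
  shows "poisson_mean a (p * p) \<ge> 0" and "poisson_mean a (p * p) = 0 \<Longrightarrow> p = 0"
proof -
  show "poisson_mean a (p * p) \<ge> 0"
    by (simp add: poisson_mean_def)
  assume "poisson_mean a (p * p) = 0"
  then have "AE n in measure_pmf (poisson_pmf a). poly p (real n) * poly p (real n) = 0"
    using integrable_poisson_poly[OF a, of "p * p"]
    by (subst (asm) poisson_mean_def, subst (asm) integral_nonneg_eq_0_iff_AE) auto
  then have "poly p (real n) = 0" for n
    using a by (simp add: AE_measure_pmf_iff)
  then have "range real \<subseteq> {x. poly p x = 0}" by auto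
  moreover have "infinite (range real)"
    by (metis finite_imageD infinite_UNIV_nat inj_of_nat)
  ultimately show "p = 0"
    using poly_roots_finite finite_subset by blast
qed

subsection \<open>Charlier polynomials\<close>

lemma degree_lead_coeff_charlier [simp]:
  "degree (charlier a n) = n \<and> lead_coeff (charlier a n) = 1"
proof (induction a n rule: charlier.induct)
  case (3 a n)
  let ?p = "[:- real (Suc n) - a, 1:] * charlier a (Suc n)"
  let ?q = "smult (real (Suc n) * a) (charlier a n)"
  have IH: "degree (charlier a (Suc n)) = Suc n" "coeff (charlier a (Suc n)) (Suc n) = 1"
    using 3 by metis+
  then have nz: "charlier a (Suc n) \<noteq> 0" by auto
  have p: "degree ?p = Suc (Suc n)" "lead_coeff ?p = 1"
    using IH nz by (simp_all only: lead_coeff_mult)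
      (simp_all add: degree_mult_eq del: mult_pCons_left charlier.simps)
  moreover have "degree (- ?q) < degree ?p"
    unfolding p using 3 by (simp add: degree_smult_eq)
  ultimately have "degree (?p + - ?q) = Suc (Suc n)" "lead_coeff (?p + - ?q) = 1"
    by (metis degree_add_eq_left, metis add.commute lead_coeff_add_le)
  then show ?case by simp
qed auto

lemma degree_charlier [simp]: "degree (charlier a n) = n"
  and coeff_charlier [simp]: "coeff (charlier a n) n = 1"
  using degree_lead_coeff_charlier[of a n] by auto

lemma charlier_nonzero [simp]: "charlier a n \<noteq> 0"
  using coeff_charlier[of a n] by (metis coeff_0 zero_neq_one)

text \<open>For \<open>n = 0\<close> the truncated index \<open>n - 1\<close> is harmless, because
  its coefficient \<open>real n\<close> is 0. This gives one recurrence for all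
  \<open>n\<close>.\<close>

lemma poly_charlier_Suc:
  "poly (charlier a (Suc n)) x =
    (x - real n - a) * poly (charlier a n) x - real n * a * poly (charlier a (n - 1)) x"
  by (cases n) (auto simp: algebra_simps)

lemma fwd_diff_charlier:
  "fwd_diff (poly (charlier a n)) x = real n * poly (charlier a (n - 1)) x"
proof (induction a n rule: charlier.induct)
  case (3 a n)
  have IH: "poly (charlier a (Suc n)) (x + 1) = poly (charlier a (Suc n)) x + real (Suc n) * poly (charlier a n) x"
    "poly (charlier a n) (x + 1) = poly (charlier a n) x + real n * poly (charlier a (n - 1)) x"
    using 3 by (simp_all add: fwd_diff_def del: charlier.simps)
  show ?case
    unfolding fwd_diff_def poly_charlier_Suc[of a "Suc n"] IH diff_Suc_1
    unfolding poly_charlier_Suc[of a n] by (simp add: algebra_simps)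
qed (auto simp: fwd_diff_def)

text \<open>The raising relation follows from the recurrence once values at \<open>x - 1\<close> are
  eliminated by the lowering relation \<open>fwd_diff_charlier\<close>.\<close>

lemma charlier_raising:
  "poly (charlier a (Suc n)) x = x * poly (charlier a n) (x - 1) - a * poly (charlier a n) x"
proof (induction n)
  case (Suc n)
  have "poly (charlier a (Suc n)) x =
      poly (charlier a (Suc n)) (x - 1) + real (Suc n) * poly (charlier a n) (x - 1)"
    using fwd_diff_charlier[of a "Suc n" "x - 1"] by (simp add: fwd_diff_def del: charlier.simps)
  then have "x * poly (charlier a (Suc n)) (x - 1) =
      x * poly (charlier a (Suc n)) x - real (Suc n) * (x * poly (charlier a n) (x - 1))"
    by (simp add: algebra_simps del: charlier.simps)
  also have "x * poly (charlier a n) (x - 1) = poly (charlier a (Suc n)) x + a * poly (charlier a n) x"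
    using Suc by simp
  finally show ?case
    unfolding poly_charlier_Suc[of a "Suc n"] diff_Suc_1
    by (simp add: algebra_simps del: charlier.simps)
qed auto

text \<open>The raising operator is \<open>a\<close> times the adjoint of the forward difference:
  the Poisson shift turns the mean of x C(x - 1) q(x) into \<open>a\<close> times the mean of C(x)
  q(x + 1).\<close>

lemma charlier_ip_Suc:
  assumes "a > 0"
  shows "charlier_ip a (charlier a (Suc n)) q =
    a * charlier_ip a (charlier a n) (pcompose q [:1, 1:] - q)"
proof -
  have "charlier a (Suc n) * q =
      [:0, 1:] * pcompose (charlier a n * pcompose q [:1, 1:]) [:-1, 1:] - smult a (charlier a n * q)"
    by (subst poly_eq_poly_eq_iff[symmetric])
      (auto simp: fun_eq_iff charlier_raising poly_pcompose algebra_simps simp del: charlier.simps)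
  then show ?thesis
    unfolding charlier_ip_eq using assms
    by (simp add: poisson_mean_diff poisson_mean_smult poisson_mean_shift right_diff_distrib
        del: charlier.simps mult_pCons_left)
qed

lemma charlier_ip_commute: "charlier_ip a p q = charlier_ip a q p"
  by (simp add: charlier_ip_def mult.commute)

lemma charlier_ip_charlier_Suc:
  assumes "a > 0"
  shows "charlier_ip a (charlier a (Suc n)) (charlier a m) =
    a * real m * charlier_ip a (charlier a n) (charlier a (m - 1))"
proof -
  have "pcompose (charlier a m) [:1, 1:] - charlier a m = smult (real m) (charlier a (m - 1))"
    using fwd_diff_charlier[of a m]
    by (subst poly_eq_poly_eq_iff[symmetric])
      (auto simp: fun_eq_iff fwd_diff_def poly_pcompose add.commute)
  then show ?thesis
    unfolding charlier_ip_Suc[OF assms]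
    by (simp add: charlier_ip_eq poisson_mean_smult del: charlier.simps)
qed

text \<open>The adjoint relation lowers both indices together until one reaches 0. On the diagonal
  each step contributes a factor \<open>a\<close> times the index.\<close>

lemma charlier_ip_charlier:
  assumes a: "a > 0"
  shows "charlier_ip a (charlier a n) (charlier a m) = (if n = m then fact n * a ^ n else 0)"
proof (induction n arbitrary: m)
  case 0
  show ?case
  proof (cases m)
    case 0
    then show ?thesis by (simp add: charlier_ip_eq poisson_mean_1)
  next
    case (Suc k)
    then show ?thesis
      using charlier_ip_charlier_Suc[OF a, of k 0] charlier_ip_commute by (simp del: charlier.simps)
  qed
next
  case (Suc n)
  then show ?case
    unfolding charlier_ip_charlier_Suc[OF a] by (cases m) auto
qed

text \<open>Let W(n) be the cross difference in the numerator. The recurrence gives W(n+1) = (x - y)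
  C(n+1,x) C(n+1,y) + (n+1) a W(n), which telescopes after division by the squared norms.\<close>

lemma christoffel_darboux_charlier:
  assumes "a > 0"
  shows "(x - y) * (\<Sum>k\<le>n. poly (charlier a k) x * poly (charlier a k) y / (fact k * a ^ k)) =
    (poly (charlier a (Suc n)) x * poly (charlier a n) y
      - poly (charlier a n) x * poly (charlier a (Suc n)) y) / (fact n * a ^ n)"
proof (induction n)
  case (Suc n)
  define h :: real where "h = fact n * a ^ n"
  have h: "h \<noteq> 0" "fact (Suc n) * a ^ Suc n = real (Suc n) * a * h"
    using assms by (auto simp: h_def algebra_simps)
  let ?X = "\<lambda>k. poly (charlier a k) x" and ?Y = "\<lambda>k. poly (charlier a k) y"
  \<comment> \<open>Multiplying by the squared norm of index \<open>Suc n\<close> clears all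
    denominators.\<close>
  have "real (Suc n) * a * h * ((x - y) * (\<Sum>k\<le>Suc n. ?X k * ?Y k / (fact k * a ^ k))) =
      real (Suc n) * a * h * ((?X (Suc n) * ?Y n - ?X n * ?Y (Suc n)) / h)
      + (x - y) * (?X (Suc n) * ?Y (Suc n))"
    unfolding sum.atMost_Suc distrib_left[of "x - y"] Suc h_def[symmetric] h(2)
    using h assms by (simp add: field_simps del: charlier.simps of_nat_Suc)
  also have "\<dots> = ?X (Suc (Suc n)) * ?Y (Suc n) - ?X (Suc n) * ?Y (Suc (Suc n))"
    unfolding poly_charlier_Suc[of a "Suc n"] diff_Suc_1
    using h(1) by (simp add: field_simps del: charlier.simps of_nat_Suc)
  finally show ?case
    unfolding h(2) using h(1) assms by (simp add: field_simps del: charlier.simps of_nat_Suc)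
qed (auto simp: algebra_simps)

section \<open>Zeros of the Charlier polynomials\<close>

lemma poly_charlier_0: "poly (charlier a n) 0 = (- a) ^ n"
  by (induction n) (simp_all add: charlier_raising del: charlier.simps(2,3))

text \<open>At a zero of C_n the recurrence leaves only - n a C_{n-1}, so the sign of C_{n-1} at the
  zeros of C_n is carried through the induction. Taking 0 as the leftmost test point makes all zeros
  positive.\<close>

lemma zeros_charlier:
  assumes a: "a > 0"
  shows "length (zeros (charlier a n)) = n" (is "?len n")
    and "sorted_wrt (<) (zeros (charlier a n))" (is "?sorted n")
    and "\<And>k. k < n \<Longrightarrow> 0 < zeros (charlier a n) ! k"
    and "\<And>k. k < n \<Longrightarrow> 0 < (-1) ^ (n - Suc k) * poly (charlier a (n - 1)) (zeros (charlier a n) ! k)"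
proof -
  have "?len n \<and> ?sorted n \<and> (\<forall>k<n. 0 < zeros (charlier a n) ! k \<and>
      0 < (-1) ^ (n - Suc k) * poly (charlier a (n - 1)) (zeros (charlier a n) ! k))"
  proof (induction n)
    case (Suc n)
    define z where "z k = zeros (charlier a n) ! k" for k
    have z_less: "z i < z j" if "i < j" "j < n" for i j
      using Suc that by (auto simp: z_def sorted_wrt_iff_nth_less)
    obtain M where M: "M > (if n = 0 then 0 else z (n - 1))" "0 < poly (charlier a (Suc n)) M"
      using monic_positive_above[of "charlier a (Suc n)"] by (auto simp del: charlier.simps)
    \<comment> \<open>The test points are 0, the zeros of C_n, and a point \<open>M\<close> beyond
      them where C_{n+1} is positive.\<close>
    define w where "w k = (if k = 0 then 0 else if k \<le> n then z (k - 1) else M)" for k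
    have w_less: "w k < w (Suc k)" if "k < Suc n" for k
      using Suc that M(1) z_less[of "k - 1" k]
      by (cases "k = n") (auto simp: w_def z_def split: if_splits)
    have w_sign: "0 < (-1) ^ (Suc n - k) * poly (charlier a (Suc n)) (w k)" if "k \<le> Suc n" for k
    proof -
      consider "k = 0" | j where "k = Suc j" "j < n" | "k = Suc n"
        using \<open>k \<le> Suc n\<close> by (cases k) (auto simp: le_less)
      then show ?thesis
      proof cases
        case 1
        have "(-1) ^ Suc n * (- a) ^ Suc n = a ^ Suc n"
          by (simp only: power_mult_distrib[symmetric]) simp
        with 1 a show ?thesis
          by (simp add: w_def poly_charlier_0 del: power_Suc charlier.simps)
      next
        case 2
        have "poly (charlier a n) (z j) = 0"
          using Suc 2 by (auto simp: z_def intro: poly_zeros_nth)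
        moreover have "0 < (-1) ^ (n - Suc j) * poly (charlier a (n - 1)) (z j)"
          using Suc 2 by (simp add: z_def)
        moreover have "(-1::real) ^ (n - j) = - ((-1) ^ (n - Suc j))"
          using 2 by (metis Suc_diff_Suc mult_minus1 power_Suc)
        ultimately show ?thesis
          using 2 a by (simp add: w_def poly_charlier_Suc zero_less_mult_iff mult.left_commute[of "(-1) ^ _"]
              del: charlier.simps)
      qed (use M in \<open>simp add: w_def del: charlier.simps\<close>)
    qed
    have zeros: "length (zeros (charlier a (Suc n))) = Suc n" "sorted_wrt (<) (zeros (charlier a (Suc n)))"
      "\<And>k. k < Suc n \<Longrightarrow> w k < zeros (charlier a (Suc n)) ! k \<and> zeros (charlier a (Suc n)) ! k < w (Suc k)"
      using alternating_zeros[OF degree_charlier charlier_nonzero, of "Suc n" w a] w_less w_sign by blast+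
    have w_nonneg: "0 \<le> w k" if "k \<le> n" for k
      using Suc that by (auto simp: w_def z_def less_imp_le)
    have "0 < zeros (charlier a (Suc n)) ! k \<and>
        0 < (-1) ^ (n - k) * poly (charlier a n) (zeros (charlier a (Suc n)) ! k)" if "k < Suc n" for k
    proof
      show "0 < zeros (charlier a (Suc n)) ! k"
        using zeros(3)[OF that] w_nonneg[of k] that by linarith
      show "0 < (-1) ^ (n - k) * poly (charlier a n) (zeros (charlier a (Suc n)) ! k)"
      \<comment> \<open>Zero \<open>k\<close> of C_{n+1} lies between zeros \<open>k - 1\<close> and
        \<open>k\<close> of C_n, which fixes the sign of C_n there.\<close>
      proof (rule sign_between_zeros)
        show "zeros (charlier a n) ! (k - 1) < zeros (charlier a (Suc n)) ! k" if "0 < k"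
          using zeros(3)[OF \<open>k < Suc n\<close>] that \<open>k < Suc n\<close> by (auto simp: w_def z_def)
        show "zeros (charlier a (Suc n)) ! k < zeros (charlier a n) ! k" if "k < n"
          using zeros(3)[OF \<open>k < Suc n\<close>] that by (auto simp: w_def z_def)
      qed (use Suc that in auto)
    qed
    with zeros(1,2) show ?case by (simp del: charlier.simps)
  qed (simp add: zeros_def)
  then show "?len n" "?sorted n" "\<And>k. k < n \<Longrightarrow> 0 < zeros (charlier a n) ! k"
    "\<And>k. k < n \<Longrightarrow> 0 < (-1) ^ (n - Suc k) * poly (charlier a (n - 1)) (zeros (charlier a n) ! k)"
    by auto
qed

subsection \<open>The discrete Sobolev inner product\<close>

text \<open>Subtracting the leading coefficient times the basis element of the same degree lowers
  the degree. The alternative \<open>p = 0\<close> is listed separately because the zero polynomial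
  has degree 0, which is not below \<open>m = 0\<close>.\<close>

lemma graded_basis_induct:
  fixes P :: "nat \<Rightarrow> real poly"
  assumes basis: "\<And>k. degree (P k) = k" "\<And>k. lead_coeff (P k) = 1"
    and "p = 0 \<or> degree p < m"
    and zero: "Q 0" and step: "\<And>b k p. k < m \<Longrightarrow> Q p \<Longrightarrow> Q (p + smult b (P k))"
  shows "Q p"
proof -
  have "Q p" if "p = 0 \<or> degree p < d" "d \<le> m" for d p
    using that
  proof (induction d arbitrary: p)
    case (Suc d)
    let ?r = "p - smult (coeff p d) (P d)"
    have "degree ?r \<le> d"
      using Suc.prems basis(1)[of d] by (intro degree_diff_le) (auto intro: order_trans[OF degree_smult_le])
    moreover have "coeff ?r d = 0"
      using basis[of d] by simp
    ultimately have "?r = 0 \<or> degree ?r < d"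
      by (metis leading_coeff_0_iff le_neq_implies_less)
    then have "Q (?r + smult (coeff p d) (P d))"
      using Suc by (intro step) auto
    then show ?case by simp
  qed (use zero in simp)
  with assms(3) show ?thesis by blast
qed

lemma fwd_diff_poly_add: "fwd_diff (poly (p + q)) x = fwd_diff (poly p) x + fwd_diff (poly q) x"
  and fwd_diff_poly_diff: "fwd_diff (poly (p - q)) x = fwd_diff (poly p) x - fwd_diff (poly q) x"
  and fwd_diff_poly_smult: "fwd_diff (poly (smult b p)) x = b * fwd_diff (poly p) x"
  by (simp_all add: fwd_diff_def algebra_simps)

lemma fwd_diff_poly_sum: "fwd_diff (poly (\<Sum>i\<in>A. f i)) x = (\<Sum>i\<in>A. fwd_diff (poly (f i)) x)"
  by (simp add: fwd_diff_def poly_sum sum_subtractf)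

lemmas fwd_diff_poly = fwd_diff_poly_add fwd_diff_poly_diff fwd_diff_poly_smult

text \<open>After cancelling factor \<open>k\<close>, every remaining factor is positive and larger
  at \<open>x\<close> than at \<open>y\<close>; \<open>n \<ge> 2\<close> leaves at least one, hence
  strictness. It will be applied at \<open>c\<close> and \<open>c + 1\<close>.\<close>

lemma prod_quotient_decreasing:
  fixes z :: "nat \<Rightarrow> real"
  assumes k: "k < n" and n: "n \<ge> 2" and z: "\<And>j. j < n \<Longrightarrow> y < z j" and "x < y"
  shows "(\<Prod>j<n. z j - y) / (z k - y) < (\<Prod>j<n. z j - x) / (z k - x)"
proof -
  let ?A = "{..<n} - {k}"
  have "(\<Prod>j<n. z j - w) / (z k - w) = (\<Prod>j\<in>?A. z j - w)" if "w \<le> y" for w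
    using z[OF k] that k by (subst prod.remove[of _ k]) auto
  moreover have "(\<Prod>j\<in>?A. z j - y) < (\<Prod>j\<in>?A. z j - x)"
  proof -
    have "card ?A \<noteq> 0" using n k by simp
    then obtain i where "i \<in> ?A" by (metis card.empty ex_in_conv)
    then show ?thesis
      using z \<open>x < y\<close> by (intro prod_mono_strict[of i]) (auto simp: less_imp_le intro: order.strict_trans)
  qed
  ultimately show ?thesis using \<open>x < y\<close> by simp
qed

context
  fixes a :: real
  assumes a: "a > 0"
begin

section \<open>Orthogonality and the kernels of the forward difference at \<open>c\<close>\<close>

lemma charlier_ip_bilinear:
  "charlier_ip a p 0 = 0"
  "charlier_ip a p (q + r) = charlier_ip a p q + charlier_ip a p r"
  "charlier_ip a (q + r) p = charlier_ip a q p + charlier_ip a r p"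
  "charlier_ip a (q - r) p = charlier_ip a q p - charlier_ip a r p"
  "charlier_ip a p (smult b q) = b * charlier_ip a p q"
  "charlier_ip a (smult b q) p = b * charlier_ip a q p"
  using poisson_mean_smult[of a 0 0]
  by (simp_all add: charlier_ip_eq distrib_left distrib_right left_diff_distrib a
      poisson_mean_add poisson_mean_diff poisson_mean_smult)

lemma charlier_ip_sum: "charlier_ip a (\<Sum>i\<in>A. f i) p = (\<Sum>i\<in>A. charlier_ip a (f i) p)"
proof (induction A rule: infinite_finite_induct)
  case (insert i A)
  then show ?case by (simp add: charlier_ip_bilinear)
qed (simp_all add: charlier_ip_commute[of a 0] charlier_ip_bilinear)

lemma charlier_orthogonal_lower:
  assumes "p = 0 \<or> degree p < n"
  shows "charlier_ip a (charlier a n) p = 0"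
  by (rule graded_basis_induct[of "charlier a" p n])
    (use assms in \<open>auto simp: charlier_ip_bilinear charlier_ip_charlier[OF a]\<close>)

text \<open>On a Charlier polynomial, orthogonality selects a single summand of the kernel;
  linearity extends this to all degrees up to \<open>m\<close>.\<close>

lemma kernel01_reproducing:
  assumes "p = 0 \<or> degree p \<le> m"
  shows "charlier_ip a (kernel01 a c m) p = fwd_diff (poly p) c"
proof (rule graded_basis_induct[of "charlier a" p "Suc m"])
  fix b k q assume "k < Suc m" and IH: "charlier_ip a (kernel01 a c m) q = fwd_diff (poly q) c"
  let ?f = "\<lambda>k. fwd_diff (poly (charlier a k)) c"
  have "charlier_ip a (kernel01 a c m) (charlier a k) = (\<Sum>j\<le>m. if j = k then ?f k else 0)"
    unfolding kernel01_def charlier_ip_sum using a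
    by (intro sum.cong) (auto simp: charlier_ip_bilinear charlier_ip_charlier[OF a])
  also have "\<dots> = ?f k"
    using \<open>k < Suc m\<close> by simp
  finally show "charlier_ip a (kernel01 a c m) (q + smult b (charlier a k)) =
      fwd_diff (poly (q + smult b (charlier a k))) c"
    by (simp add: charlier_ip_bilinear fwd_diff_poly IH)
qed (use assms in \<open>auto simp: charlier_ip_bilinear fwd_diff_def\<close>)

lemma degree_kernel01: "degree (kernel01 a c m) \<le> m"
  unfolding kernel01_def by (intro degree_sum_le) (auto intro: order_trans[OF degree_smult_le])

lemma fwd_diff_kernel01: "fwd_diff (poly (kernel01 a c m)) c = kernel11 a c m"
  by (simp add: kernel01_def kernel11_def fwd_diff_poly_sum fwd_diff_poly power2_eq_square)

lemma kernel11_nonneg: "kernel11 a c m \<ge> 0"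
  unfolding kernel11_def using a by (intro sum_nonneg) (simp add: charlier_ip_charlier)

lemma kernel11_pos:
  assumes "m \<ge> 1"
  shows "kernel11 a c m > 0"
  unfolding kernel11_def
\<comment> \<open>The term of index 1 is positive because the difference of C_1 is 1.\<close>
proof (rule sum_pos2[of _ 1])
  show "0 < (fwd_diff (poly (charlier a 1)) c)\<^sup>2 / charlier_ip a (charlier a 1) (charlier a 1)"
    unfolding fwd_diff_charlier charlier_ip_charlier[OF a] using a by simp
qed (use a assms in \<open>auto simp: charlier_ip_charlier\<close>)

lemma kernel01_0: "kernel01 a c 0 = 0"
  by (simp add: kernel01_def fwd_diff_def)

text \<open>The scalar \<open>b\<close> is left free so that both the Sobolev and the limit
  polynomials are covered. For \<open>n = 0\<close> the truncated index gives the kernel of index 0,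
  which vanishes.\<close>

lemma charlier_minus_kernel01:
  "degree (charlier a n - smult b (kernel01 a c (n - 1))) = n"
  "lead_coeff (charlier a n - smult b (kernel01 a c (n - 1))) = 1"
proof -
  let ?r = "- smult b (kernel01 a c (n - 1))"
  have "degree (charlier a n + ?r) = n \<and> lead_coeff (charlier a n + ?r) = 1"
  proof (cases n)
    case 0
    then show ?thesis by (simp add: kernel01_0)
  next
    case (Suc m)
    have "degree (smult b (kernel01 a c m)) \<le> degree (kernel01 a c m)"
      by (rule degree_smult_le)
    then have "degree ?r < degree (charlier a n)"
      using degree_kernel01[of c m] unfolding degree_charlier Suc degree_minus by simp
    then show ?thesis
      by (metis add.commute degree_add_eq_left degree_lead_coeff_charlier lead_coeff_add_le)
  qed
  then show "degree (charlier a n - smult b (kernel01 a c (n - 1))) = n"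
    "lead_coeff (charlier a n - smult b (kernel01 a c (n - 1))) = 1"
    by (auto simp only: diff_conv_add_uminus)
qed

section \<open>Uniqueness and explicit form of the Sobolev orthogonal polynomials\<close>

lemma sobolev_ip_bilinear:
  "sobolev_ip a c t p 0 = 0"
  "sobolev_ip a c t p (q + r) = sobolev_ip a c t p q + sobolev_ip a c t p r"
  "sobolev_ip a c t (q - r) p = sobolev_ip a c t q p - sobolev_ip a c t r p"
  "sobolev_ip a c t p (smult b q) = b * sobolev_ip a c t p q"
  by (simp_all add: sobolev_ip_def charlier_ip_bilinear fwd_diff_def algebra_simps)

lemma sobolev_ip_commute: "sobolev_ip a c t p q = sobolev_ip a c t q p"
  by (simp add: sobolev_ip_def charlier_ip_commute[of a p])

lemma monic_orthogonal_sobolev_lower: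
  assumes P: "monic_orthogonal (sobolev_ip a c t) P" and "p = 0 \<or> degree p < n"
  shows "sobolev_ip a c t (P n) p = 0"
proof -
  have basis: "degree (P k) = k" "lead_coeff (P k) = 1" for k
    using P unfolding monic_orthogonal_def by blast+
  show ?thesis
  proof (rule graded_basis_induct[of P p n])
    fix b k q assume "k < n" "sobolev_ip a c t (P n) q = 0"
    moreover have "sobolev_ip a c t (P n) (P k) = 0"
      using P \<open>k < n\<close> by (simp add: monic_orthogonal_def)
    ultimately show "sobolev_ip a c t (P n) (q + smult b (P k)) = 0"
      by (simp add: sobolev_ip_bilinear)
  qed (use basis assms(2) in \<open>simp_all add: sobolev_ip_bilinear\<close>)
qed

text \<open>The difference of the two monic polynomials has lower degree, so it is orthogonal to
  itself. Its Sobolev square is a sum of two nonnegative terms, and the Poisson part alone already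
  forces it to be 0.\<close>

lemma monic_orthogonal_sobolev_unique:
  assumes t: "t > 0"
    and P: "monic_orthogonal (sobolev_ip a c t) P" and Q: "monic_orthogonal (sobolev_ip a c t) Q"
  shows "P n = Q n"
proof -
  let ?d = "P n - Q n"
  have "degree (P n) = n" "degree (Q n) = n" "coeff (P n) n = 1" "coeff (Q n) n = 1"
    using P Q unfolding monic_orthogonal_def by metis+
  then have "degree ?d \<le> n" "coeff ?d n = 0"
    by (auto intro: degree_diff_le)
  then have "?d = 0 \<or> degree ?d < n"
    by (metis leading_coeff_0_iff le_neq_implies_less)
  then have "sobolev_ip a c t ?d ?d = 0"
    using P Q monic_orthogonal_sobolev_lower by (simp add: sobolev_ip_bilinear)
  then have "poisson_mean a (?d * ?d) + t * (fwd_diff (poly ?d) c)\<^sup>2 = 0"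
    by (simp add: sobolev_ip_def charlier_ip_eq power2_eq_square mult.assoc)
  moreover have "0 \<le> t * (fwd_diff (poly ?d) c)\<^sup>2" using t by simp
  ultimately have "poisson_mean a (?d * ?d) = 0"
    using poisson_mean_square(1)[OF a, of ?d] by linarith
  then show ?thesis
    using poisson_mean_square(2)[OF a, of ?d] by simp
qed

text \<open>Let F be the difference of C_n at \<open>c\<close> and K the value of
  \<open>kernel11\<close>. Pairing C_n - b \<open>kernel01\<close> with a polynomial of lower degree
  gives (t F - b (1 + t K)) times its difference at \<open>c\<close>, so orthogonality fixes b = t F
  / (1 + t K). Uniqueness then resolves the definite description.\<close>

lemma sobolev_charlier_eq:
  assumes t: "t > 0"
  shows "sobolev_charlier a c t n = charlier a n -
    smult (t * fwd_diff (poly (charlier a n)) c / (1 + t * kernel11 a c (n - 1))) (kernel01 a c (n - 1))"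
proof -
  define Q where "Q n = charlier a n -
    smult (t * fwd_diff (poly (charlier a n)) c / (1 + t * kernel11 a c (n - 1))) (kernel01 a c (n - 1))"
    for n
  have Q: "degree (Q n) = n" "lead_coeff (Q n) = 1" for n
    unfolding Q_def by (rule charlier_minus_kernel01)+
  have lower: "sobolev_ip a c t (Q n) (Q m) = 0" if "m < n" for m n
  proof -
    let ?f = "fwd_diff (poly (charlier a n)) c" and ?K = "kernel11 a c (n - 1)"
    have K: "1 + t * ?K \<noteq> 0"
      using kernel11_nonneg[of c "n - 1"] t by (smt (verit) mult_nonneg_nonneg)
    have low: "degree (Q m) < n" using Q(1)[of m] that by simp
    then have reproducing: "charlier_ip a (kernel01 a c (n - 1)) (Q m) = fwd_diff (poly (Q m)) c"
      by (intro kernel01_reproducing) auto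
    have "charlier_ip a (Q n) (Q m) = - (t * ?f / (1 + t * ?K)) * fwd_diff (poly (Q m)) c"
      unfolding Q_def[of n]
      by (simp add: charlier_ip_bilinear charlier_orthogonal_lower low reproducing[simplified])
    moreover have "fwd_diff (poly (Q n)) c = ?f / (1 + t * ?K)"
      unfolding Q_def using K by (simp add: fwd_diff_poly fwd_diff_kernel01 field_simps)
    ultimately show ?thesis
      by (simp add: sobolev_ip_def)
  qed
  have ortho: "monic_orthogonal (sobolev_ip a c t) Q"
    unfolding monic_orthogonal_def
  proof (intro conjI allI impI)
    show "sobolev_ip a c t (Q m) (Q n) = 0" if "m \<noteq> n" for m n
      using lower[of m n] lower[of n m] that sobolev_ip_commute by (cases "m < n") auto
  qed (rule Q)+
  have "sobolev_charlier a c t = Q"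
    unfolding sobolev_charlier_def
    by (rule the_equality) (use ortho monic_orthogonal_sobolev_unique[OF t] in auto)
  then show ?thesis by (simp add: Q_def)
qed

section \<open>Signs and zeros of the limit polynomial\<close>

lemma poly_kernel01:
  "(x - c) * (x - (c + 1)) * poly (kernel01 a c m) x =
    ((x - c) * (poly (charlier a (Suc m)) x * poly (charlier a m) (c + 1)
        - poly (charlier a m) x * poly (charlier a (Suc m)) (c + 1))
     - (x - (c + 1)) * (poly (charlier a (Suc m)) x * poly (charlier a m) c
        - poly (charlier a m) x * poly (charlier a (Suc m)) c)) / (fact m * a ^ m)"
proof -
  \<comment> \<open>\<open>S\<close> is the ordinary Christoffel-Darboux kernel;
    \<open>kernel01\<close> is its forward difference in the second variable.\<close>
  define S where "S y = (\<Sum>k\<le>m. poly (charlier a k) x * poly (charlier a k) y / (fact k * a ^ k))" for y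
  have eq: "poly (kernel01 a c m) x = S (c + 1) - S c"
    unfolding kernel01_def S_def fwd_diff_def charlier_ip_charlier[OF a]
    by (simp add: poly_sum sum_subtractf[symmetric] diff_divide_distrib algebra_simps)
  \<comment> \<open>Keeping both denominators as factors makes the identity valid at
    \<open>x = c\<close> and \<open>x = c + 1\<close> too.\<close>
  have "(x - c) * (x - (c + 1)) * poly (kernel01 a c m) x =
      (x - c) * ((x - (c + 1)) * S (c + 1)) - (x - (c + 1)) * ((x - c) * S c)"
    unfolding eq by (simp add: algebra_simps)
  then show ?thesis
    unfolding S_def christoffel_darboux_charlier[OF a]
    by (simp add: diff_divide_distrib right_diff_distrib)
qed

text \<open>At a zero z of C_n the limit polynomial becomes a product of three factors of known
  sign: the difference of C_n at \<open>c\<close>, the value C_{n-1}(z), and a difference of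
  quotients of C_n at \<open>c\<close> and \<open>c + 1\<close>.\<close>

lemma limit_charlier_sign:
  assumes c: "c < -1" and n: "n \<ge> 2" and k: "k < n"
  shows "0 < (-1) ^ (n - Suc k) * poly (limit_charlier a c n) (zeros (charlier a n) ! k)"
proof -
  define m where "m = n - 1"
  define z where "z = zeros (charlier a n) ! k"
  define h where "h = fact m * a ^ m"
  define K where "K = kernel11 a c m"
  \<comment> \<open>The sign makes \<open>P\<close> the product of the differences zero minus
    \<open>y\<close>, hence positive to the left of all zeros.\<close>
  define P where "P y = (-1) ^ n * poly (charlier a n) y" for y
  have m: "n = Suc m" "m \<ge> 1" using n by (simp_all add: m_def)
  note zeros = zeros_charlier[OF a, where n = n]
  have z: "0 < z" "poly (charlier a n) z = 0"
    using zeros(1,3) k by (auto simp: z_def poly_zeros_nth)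
  have pos: "h > 0" "K > 0"
    using a m kernel11_pos by (auto simp: h_def K_def)
  have P_eq: "P y = (\<Prod>j<n. zeros (charlier a n) ! j - y)" for y
  proof -
    have "P y = (\<Prod>j<n. -1) * (\<Prod>j<n. y - zeros (charlier a n) ! j)"
      unfolding P_def using zeros(1,2) by (subst poly_eq_prod_zeros[of _ n]) auto
    also have "\<dots> = (\<Prod>j<n. - 1 * (y - zeros (charlier a n) ! j))"
      by (rule prod.distrib[symmetric])
    finally show ?thesis by simp
  qed
  have "P (c + 1) / (z - (c + 1)) < P c / (z - c)"
    unfolding P_eq z_def using zeros(3) c n k
    by (intro prod_quotient_decreasing) (auto intro: order.strict_trans[of _ 0])
  then have D: "0 < P c / (z - c) - P (c + 1) / (z - (c + 1))" by simp
  \<comment> \<open>By the lowering relation this difference is n C_{n-1}(c), and \<open>c\<close>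
    lies to the left of the zeros of C_{n-1}.\<close>
  have F: "0 < (-1) ^ m * fwd_diff (poly (charlier a n)) c"
  proof -
    have "0 < (-1) ^ (m - 0) * poly (charlier a m) c"
      using zeros_charlier[OF a, where n = m] c
      by (intro sign_between_zeros) (auto intro: order.strict_trans[of _ 0])
    then show ?thesis
      using m unfolding fwd_diff_charlier
      by (simp add: mult.left_commute[of "(-1) ^ m"])
  qed
  have B: "0 < (-1) ^ (n - Suc k) * poly (charlier a m) z"
    using zeros(4)[OF k] by (simp add: m_def z_def)
  have nz: "z - c \<noteq> 0" "z - (c + 1) \<noteq> 0" using z c by auto
  then have nz': "(z - c) * (z - (c + 1)) \<noteq> 0" by (rule no_zero_divisors)
  have "(z - c) * (z - (c + 1)) * poly (kernel01 a c m) z = poly (charlier a m) z / h *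
      ((z - (c + 1)) * poly (charlier a n) c - (z - c) * poly (charlier a n) (c + 1))"
    unfolding poly_kernel01 m(1)[symmetric] z(2) h_def[symmetric]
    by (simp add: algebra_simps diff_divide_distrib add_divide_distrib)
  also have "\<dots> = (z - c) * (z - (c + 1)) * (poly (charlier a m) z / h *
      (poly (charlier a n) c / (z - c) - poly (charlier a n) (c + 1) / (z - (c + 1))))"
    using nz by (simp add: divide_simps)
  finally have kernel: "poly (kernel01 a c m) z = poly (charlier a m) z / h *
      (poly (charlier a n) c / (z - c) - poly (charlier a n) (c + 1) / (z - (c + 1)))"
    using mult_left_cancel[OF nz'] by blast
  \<comment> \<open>This absorbs the minus sign in \<open>limit_charlier\<close> and hands one power
    of -1 to \<open>F\<close> and the other to \<open>P\<close>.\<close>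
  have sq: "(-1) ^ m * (-1) ^ n = (-1 :: real)"
    unfolding m(1) by (simp add: power_mult_distrib[symmetric])
  have "(-1) ^ (n - Suc k) * poly (limit_charlier a c n) z =
      - ((-1) ^ (n - Suc k) * (fwd_diff (poly (charlier a n)) c / K) * poly (kernel01 a c m) z)"
    unfolding limit_charlier_def m_def[symmetric] K_def[symmetric] by (simp add: z)
  also have "\<dots> = ((-1) ^ m * (-1) ^ n) * (-1) ^ (n - Suc k) * (fwd_diff (poly (charlier a n)) c / K)
      * poly (kernel01 a c m) z"
    unfolding sq by simp
  also have "\<dots> = ((-1) ^ m * fwd_diff (poly (charlier a n)) c / K)
      * ((-1) ^ (n - Suc k) * poly (charlier a m) z / h) * (P c / (z - c) - P (c + 1) / (z - (c + 1)))"
    unfolding kernel P_def by (simp add: right_diff_distrib mult_ac)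
  also have "\<dots> > 0"
    using F B D pos by simp
  finally show ?thesis by (simp add: z_def)
qed

text \<open>Alternation along the zeros of C_n yields only \<open>n - 1\<close> zeros. The missing
  one lies to the left of them all, since the polynomial is monic and its sign far to the left is
  that of \<open>(-1) ^ n\<close>.\<close>

lemma zeros_limit_charlier:
  assumes c: "c < -1" and n: "n \<ge> 2"
  shows "length (zeros (limit_charlier a c n)) = n"
    and "sorted_wrt (<) (zeros (limit_charlier a c n))"
    and "\<And>k. k < n \<Longrightarrow> zeros (limit_charlier a c n) ! k < zeros (charlier a n) ! k"
    and "\<And>k. Suc k < n \<Longrightarrow> zeros (charlier a n) ! k < zeros (limit_charlier a c n) ! Suc k"
proof -
  let ?G = "limit_charlier a c n"
  define x where "x k = zeros (charlier a n) ! k" for k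
  have x_less: "x i < x j" if "i < j" "j < n" for i j
    using zeros_charlier[OF a, where n = n] that by (auto simp: x_def sorted_wrt_iff_nth_less)
  have G: "degree ?G = n" "lead_coeff ?G = 1"
    unfolding limit_charlier_def by (rule charlier_minus_kernel01)+
  then have "?G \<noteq> 0" by auto
  obtain M where M: "M < x 0" "0 < (-1) ^ n * poly ?G M"
    using monic_sign_below[OF G(2,1)] .
  define w where "w k = (if k = 0 then M else x (k - 1))" for k
  have "w k < w (Suc k)" if "k < n" for k
    using M x_less[of "k - 1" k] that by (auto simp: w_def)
  moreover have "0 < (-1) ^ (n - k) * poly ?G (w k)" if "k \<le> n" for k
    using limit_charlier_sign[OF c n, of "k - 1"] M that by (auto simp: w_def x_def)
  ultimately have zeros: "length (zeros ?G) = n" "sorted_wrt (<) (zeros ?G)"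
    "\<And>k. k < n \<Longrightarrow> w k < zeros ?G ! k \<and> zeros ?G ! k < w (Suc k)"
    using alternating_zeros[OF G(1) \<open>?G \<noteq> 0\<close>, of w] by blast+
  then show "length (zeros ?G) = n" "sorted_wrt (<) (zeros ?G)" by blast+
  show "zeros ?G ! k < zeros (charlier a n) ! k" if "k < n" for k
    using zeros(3)[OF that] by (simp add: w_def x_def)
  show "zeros (charlier a n) ! k < zeros ?G ! Suc k" if "Suc k < n" for k
    using zeros(3)[OF that] by (simp add: w_def x_def)
qed

end

section \<open>Interlacing, monotonicity and rate of convergence\<close>

lemma zeros_charlier_1: "zeros (charlier a 1) = [a]"
  by (simp add: zeros_def)

text \<open>For \<open>n = 1\<close> the difference of a constant is 0 and the three polynomials
  coincide, so the strict inequalities are stated for \<open>n \<ge> 2\<close>. The rate contains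
  \<open>kernel11\<close> because the pencil gives the limit polynomial the weight t K. Since
  \<open>c < -1\<close>, both \<open>c\<close> and \<open>c + 1\<close> are negative, while all
  Charlier zeros are positive.\<close>

theorem theorem6:
  fixes a c :: real and n :: nat
  assumes "a > 0" and "c \<notin> {-1..}" and "n \<ge> 1"
  shows
    "let C = charlier a n; Q = (\<lambda>t. sobolev_charlier a c t n); G = limit_charlier a c n;
         x = nth_zero C; \<eta> = (\<lambda>t. nth_zero (Q t)); y = nth_zero G
     in length (zeros C) = n \<and> length (zeros G) = n \<and> (\<forall>t>0. length (zeros (Q t)) = n) \<and>
        (n \<ge> 2 \<longrightarrow>
          (\<forall>t>0. (\<forall>k\<in>{1..n}. y k < \<eta> t k \<and> \<eta> t k < x k) \<and>
                 (\<forall>k\<in>{1..<n}. x k < y (k + 1)))) \<and>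
        (\<forall>k\<in>{1..n}.
          antimono_on {0<..} (\<lambda>t. \<eta> t k) \<and>
          (n \<ge> 2 \<longrightarrow> strict_antimono_on {0<..} (\<lambda>t. \<eta> t k)) \<and>
          ((\<lambda>t. \<eta> t k) \<longlongrightarrow> y k) at_top \<and>
          ((\<lambda>t. t * (\<eta> t k - y k)) \<longlongrightarrow>
             - poly C (y k) / (kernel11 a c (n - 1) * poly (pderiv G) (y k))) at_top)"
proof (cases "n = 1")
  case True
  have G: "limit_charlier a c 1 = charlier a 1"
    by (simp add: limit_charlier_def kernel01_0 assms)
  have Q: "sobolev_charlier a c t 1 = charlier a 1" if "t > 0" for t
    using that by (simp add: sobolev_charlier_eq kernel01_0 assms)
  have \<eta>: "\<forall>\<^sub>F t in at_top. nth_zero (sobolev_charlier a c t 1) 1 = a"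
    using eventually_gt_at_top[of "0::real"]
    by eventually_elim (simp only: Q nth_zero_def zeros_charlier_1 diff_self_eq_0 nth_Cons_0)
  \<comment> \<open>The claimed rate is thus a division by 0 with value 0, which is the limit of a
    quantity that vanishes for all \<open>t > 0\<close>.\<close>
  have K: "kernel11 a c (1 - 1) = 0"
    by (simp add: kernel11_def fwd_diff_def)
  have y: "nth_zero (charlier a 1) 1 = a"
    by (simp only: nth_zero_def zeros_charlier_1 diff_self_eq_0 nth_Cons_0)
  have "antimono_on {0<..} (\<lambda>t. nth_zero (sobolev_charlier a c t 1) 1)"
    by (intro monotone_onI) (simp only: greaterThan_iff Q order_refl)
  moreover have "((\<lambda>t. nth_zero (sobolev_charlier a c t 1) 1) \<longlongrightarrow> a) at_top"
    using \<eta> by (rule tendsto_eventually)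
  moreover have "((\<lambda>t. t * (nth_zero (sobolev_charlier a c t 1) 1 - a)) \<longlongrightarrow> 0) at_top"
    using \<eta> by (intro tendsto_eventually) (auto elim!: eventually_mono)
  ultimately show ?thesis
    unfolding Let_def True G K y using Q
    by (simp add: zeros_charlier_1[simplified] G[simplified] y[simplified] K[simplified])
next
  case False
  then have n: "n \<ge> 2" and c: "c < -1" and a: "a > 0"
    using assms by auto
  define K where "K = kernel11 a c (n - 1)"
  have K: "K > 0"
    unfolding K_def using n by (intro kernel11_pos[OF a]) auto
  interpret interlacing_pencil "charlier a n" "limit_charlier a c n"
    "\<lambda>t. sobolev_charlier a c t n" K n
  proof
    show "degree (limit_charlier a c n) = n" "lead_coeff (limit_charlier a c n) = 1"
      unfolding limit_charlier_def by (rule charlier_minus_kernel01[OF a])+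
    show "degree (sobolev_charlier a c t n) = n" "lead_coeff (sobolev_charlier a c t n) = 1"
      if "t > 0" for t
      unfolding sobolev_charlier_eq[OF a that] by (rule charlier_minus_kernel01[OF a])+
    show "(1 + t * K) * poly (sobolev_charlier a c t n) x =
        poly (charlier a n) x + t * K * poly (limit_charlier a c n) x" if "t > 0" for t x
    proof -
      have "1 + t * K > 0" using that K by (auto intro: add_pos_pos)
      then show ?thesis
        \<comment> \<open>After multiplication by \<open>1 + t * K\<close>, the coefficient of
          \<open>kernel01\<close> agrees on both sides because \<open>K\<close> cancels in
          \<open>t * K\<close> times F / K, with F the difference of C_n at
          \<open>c\<close>.\<close>
        unfolding sobolev_charlier_eq[OF a that] limit_charlier_def K_def[symmetric]
        using K by (simp add: field_simps)
    qed
  qed (use K zeros_charlier[OF a] zeros_limit_charlier[OF a c n] in auto)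
  \<comment> \<open>\<open>nth_zero\<close> counts from 1 and the lists of the locale from 0, so
    index \<open>k\<close> corresponds to \<open>k - 1\<close> from here on.\<close>
  have "strict_antimono_on {0<..} (\<lambda>t. nth_zero (sobolev_charlier a c t n) k)" if "k \<in> {1..n}" for k
    unfolding nth_zero_def using that by (intro monotone_onI zeros_pencil_decreasing) auto
  moreover from this have "antimono_on {0<..} (\<lambda>t. nth_zero (sobolev_charlier a c t n) k)"
    if "k \<in> {1..n}" for k
    using that by (simp add: strict_antimono_iff_antimono)
  moreover have "nth_zero (limit_charlier a c n) k < nth_zero (sobolev_charlier a c t n) k \<and>
      nth_zero (sobolev_charlier a c t n) k < nth_zero (charlier a n) k"
    if "t > 0" "k \<in> {1..n}" for t k
    unfolding nth_zero_def using that by (intro zeros_pencil) auto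
  moreover have "nth_zero (charlier a n) k < nth_zero (limit_charlier a c n) (k + 1)"
    if "k \<in> {1..<n}" for k
    unfolding nth_zero_def using that less_zeros[of "k - 1"] by simp
  moreover have "((\<lambda>t. nth_zero (sobolev_charlier a c t n) k) \<longlongrightarrow> nth_zero (limit_charlier a c n) k) at_top"
    "((\<lambda>t. t * (nth_zero (sobolev_charlier a c t n) k - nth_zero (limit_charlier a c n) k)) \<longlongrightarrow>
      - poly (charlier a n) (nth_zero (limit_charlier a c n) k)
        / (kernel11 a c (n - 1) * poly (pderiv (limit_charlier a c n)) (nth_zero (limit_charlier a c n) k))) at_top"
    if "k \<in> {1..n}" for k
    unfolding nth_zero_def K_def[symmetric]
    using zeros_pencil_tendsto[of "k - 1"] zeros_pencil_rate[of "k - 1"] that by auto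
  ultimately show ?thesis
    unfolding Let_def using p(3) q(3) zeros_pencil(1) by blast
qed

end
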